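(* Let $(G,R)$ be an arithmetical graph and let $\vec G_R$ be the associated directed graph. Then $\vec G_R$ has the Riemann-Roch property for the column chip-firing game.
   Context: $\mathbb N$ denotes the positive integers. Arithmetical graph: $G$ is a connected undirected finite loopless multigraph with vertices $v_0,\dots,v_n$ and adjacency matrix $A$; $R=(r_0,\dots,r_n)^T\in\mathbb N^{n+1}$ satisfies $\gcd(r_0,\dots,r_n)=1$, and there are $\delta_0,\dots,\delta_n\in\mathbb N$ with $(\mathcal D-A)R=\vec 0$, where $\mathcal D=\mathrm{diag}(\delta_0,\dots,\delta_n)$. The pair $(G,R)$ is then an arithmetical graph with Laplacian $Q=\mathcal D-A$. The associated directed graph $\vec G_R$ is obtained by replacing each undirected edge between $v_i$ and $v_j$ by $r_j$ edges directed from $v_i$ to $v_j$ and $r_i$ edges directed from $v_j$ to $v_i$. The Laplacian of a directed graph is $\vec Q=\mathrm{diag}(\deg^+(v_0),\dots,\deg^+(v_n))-\vec A$, where $\vec A_{i,j}$ is the number of edges from $v_i$ to $v_j$ and $\deg^+$ is out-degree; for $\vec G_R$ it equals $Q\,\mathrm{diag}(r_0,\dots,r_n)$, and its columns are orthogonal to $R$. Riemann-Roch property for the column chip-firing game: let $\Lambda$ be the lattice spanned by the columns of the Laplacian of $\vec G_R$, a rank $n$ sub-lattice of $\Lambda_R=\{D\in\mathbb Z^{n+1}:D\cdot R=0\}$, and $\deg_R(x)=x\cdot R$. $D\sim D'$ means $D-D'\in\Lambda$; $|D|=\{E\in\mathbb Z^{n+1}:E\ge\vec0,E\sim D\}$;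 $r(D)=\min\{\deg_R(E):E\in\mathbb Z^{n+1},E\ge\vec0,|D-E|=\emptyset\}-1$. Put $\Sigma(\Lambda)=\{D\in\mathbb Z^{n+1}:D\not\ge p\ \forall p\in\Lambda\}$, and let $Ext(\Sigma(\Lambda))$ be the set of $\nu\in\Sigma(\Lambda)$ with $\deg_R(\nu)\ge\deg_R(p)$ for all $p\in\Sigma(\Lambda)$ with $\sum_i|p_i-\nu_i|\le1$. The property holds if all elements of $Ext(\Sigma(\Lambda))$ have the same degree, written $g-1$, and there is $K\in\mathbb Z^{n+1}$ with $\deg_R(K)=2g-2$ and $r(D)-r(K-D)=\deg_R(D)-g+1$ for all $D\in\mathbb Z^{n+1}$. *)

theory Defs
  imports "HOL-Analysis.Analysis" "Graph_Theory.Digraph"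
begin

text \<open>The index type \<open>'v\<close> is the set of vertices \<open>v\<^sub>0, \<dots>, v\<^sub>n\<close>, so \<open>CARD('v) = n + 1\<close>; vectors in
  \<open>\<int>\<^bsup>n+1\<^esup>\<close> are \<open>int ^ 'v\<close> with the componentwise order.\<close>

subsection \<open>Arithmetical graphs\<close>

record ('v, 'e) multigraph =
  edges :: "'e set"
  ends :: "'e \<Rightarrow> 'v set"

definition connected_multigraph :: "('v::finite, 'e) multigraph \<Rightarrow> bool" where
  "connected_multigraph G \<longleftrightarrow>
     finite (edges G) \<and>
     (\<forall>e\<in>edges G. card (ends G e) = 2) \<and>
     (\<forall>u v. (u, v) \<in> {(i, j). \<exists>e\<in>edges G. ends G e = {i, j}}\<^sup>*)"

definition adj_matrix :: "('v::finite, 'e) multigraph \<Rightarrow> int ^ 'v ^ 'v" where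
  "adj_matrix G = (\<chi> i j. int (card {e \<in> edges G. ends G e = {i, j}}))"

definition int_vec :: "nat ^ 'v \<Rightarrow> int ^ 'v::finite" where
  "int_vec R = (\<chi> i. int (R $ i))"

definition diag_matrix :: "int ^ 'v \<Rightarrow> int ^ 'v ^ 'v::finite" where
  "diag_matrix d = (\<chi> i j. if i = j then d $ i else 0)"

definition arithmetical_graph :: "('v::finite, 'e) multigraph \<Rightarrow> nat ^ 'v \<Rightarrow> bool" where
  "arithmetical_graph G R \<longleftrightarrow>
     connected_multigraph G \<and>
     (\<forall>i. 0 < R $ i) \<and>
     Gcd (range (\<lambda>i. R $ i)) = 1 \<and>
     (\<exists>\<delta> :: nat ^ 'v. (\<forall>i. 0 < \<delta> $ i) \<and>
        (diag_matrix (int_vec \<delta>) - adj_matrix G) *v int_vec R = 0)"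

text \<open>The arc \<open>(e, i, j, k)\<close> is the \<open>k\<close>-th of the \<open>R $ j\<close> arcs from \<open>i\<close> to \<open>j\<close> that arise from the
  edge \<open>e\<close> with ends \<open>{i, j}\<close>; exchanging \<open>i\<close> and \<open>j\<close> gives the \<open>R $ i\<close> arcs in the other direction.\<close>

definition assoc_digraph ::
  "('v::finite, 'e) multigraph \<Rightarrow> nat ^ 'v \<Rightarrow> ('v, 'e \<times> 'v \<times> 'v \<times> nat) pre_digraph" where
  "assoc_digraph G R =
     \<lparr> verts = UNIV,
       arcs = {(e, i, j, k). e \<in> edges G \<and> ends G e = {i, j} \<and> k < R $ j},
       tail = (\<lambda>(e, i, j, k). i),
       head = (\<lambda>(e, i, j, k). j) \<rparr>"

definition laplacian :: "('v::finite, 'a) pre_digraph \<Rightarrow> int ^ 'v ^ 'v" where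
  "laplacian H =
     diag_matrix (\<chi> i. int (out_degree H i)) -
     (\<chi> i j. int (card {a \<in> arcs H. tail H a = i \<and> head H a = j}))"

subsection \<open>The Riemann-Roch property\<close>

definition deg :: "nat ^ 'v \<Rightarrow> int ^ 'v::finite \<Rightarrow> int" where
  "deg R D = (\<Sum>i\<in>UNIV. D $ i * int (R $ i))"

definition linear_system :: "(int ^ 'v) set \<Rightarrow> int ^ 'v::finite \<Rightarrow> (int ^ 'v) set" where
  "linear_system \<Lambda> D = {E. 0 \<le> E \<and> E - D \<in> \<Lambda>}"

text \<open>For positive \<open>R\<close> and \<open>\<Lambda>\<close> orthogonal to \<open>R\<close>, the degrees ranged over are nonnegative and at
  least one exists, so the least one is attained.\<close>

definition rr_rank :: "nat ^ 'v \<Rightarrow> (int ^ 'v) set \<Rightarrow> int ^ 'v::finite \<Rightarrow> int" where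
  "rr_rank R \<Lambda> D =
     (LEAST d. \<exists>E. 0 \<le> E \<and> linear_system \<Lambda> (D - E) = {} \<and> d = deg R E) - 1"

definition Sig :: "(int ^ 'v) set \<Rightarrow> (int ^ 'v::finite) set" where
  "Sig \<Lambda> = {D. \<forall>p\<in>\<Lambda>. \<not> p \<le> D}"

definition Ext :: "nat ^ 'v \<Rightarrow> (int ^ 'v) set \<Rightarrow> (int ^ 'v::finite) set" where
  "Ext R \<Lambda> = {\<nu> \<in> Sig \<Lambda>. \<forall>p \<in> Sig \<Lambda>. (\<Sum>i\<in>UNIV. \<bar>p $ i - \<nu> $ i\<bar>) \<le> 1 \<longrightarrow> deg R p \<le> deg R \<nu>}"

text \<open>Nonemptiness of \<open>Ext\<close> is required so that \<open>g - 1\<close> really is the common degree of its elements.\<close>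

definition riemann_roch_property :: "nat ^ 'v \<Rightarrow> (int ^ 'v::finite) set \<Rightarrow> bool" where
  "riemann_roch_property R \<Lambda> \<longleftrightarrow>
     (\<exists>g. Ext R \<Lambda> \<noteq> {} \<and> (\<forall>\<nu>\<in>Ext R \<Lambda>. deg R \<nu> = g - 1) \<and>
        (\<exists>K. deg R K = 2 * g - 2 \<and>
           (\<forall>D. rr_rank R \<Lambda> D - rr_rank R \<Lambda> (K - D) = deg R D - g + 1)))"

definition column_lattice :: "('v::finite, 'a) pre_digraph \<Rightarrow> (int ^ 'v) set" where
  "column_lattice H = module.span (*s) (columns (laplacian H))"

definition column_riemann_roch :: "nat ^ 'v \<Rightarrow> ('v::finite, 'a) pre_digraph \<Rightarrow> bool" where
  "column_riemann_roch R H \<longleftrightarrow> riemann_roch_property R (column_lattice H)"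

end

(* The column lattice consists of the vectors with entries \<Sum>j. w i j * (f i - f j), where
   w i j = A i j * r j, and r i * w i j is symmetric. As for undirected graphs, every linear order
   of the vertices gives a vector with entries \<Sum>{j before i}. w i j - 1. It dominates no lattice
   point, its degree does not depend on the order, and adding the vector of the reversed order
   gives a fixed canonical vector K. Dhar's burning argument shows that every vector of Sig is,
   up to a lattice point, below the vector of some order. Hence the translates of the order vectors
   are exactly Ext, and the involution x \<mapsto> K - x of this set yields the Riemann-Roch formula. *)

theory Submission
  imports Defs
begin

section \<open>Reversible weights\<close>

text \<open>Reversibility is detailed balance: it makes \<open>R\<close> orthogonal to the image of
  the Laplacian although \<open>w\<close> need not be symmetric.\<close>

locale reversible_weights =
  fixes R :: "nat ^ 'v::finite" and w :: "'v \<Rightarrow> 'v \<Rightarrow> int"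
  assumes R_pos: "0 < R $ i"
    and w_nonneg: "0 \<le> w i j"
    and w_diag: "w i i = 0"
    and w_reversible: "int (R $ i) * w i j = int (R $ j) * w j i"
    and w_connected: "(i, j) \<in> {(i, j). 0 < w i j}\<^sup>*"
begin

definition lap :: "int ^ 'v \<Rightarrow> int ^ 'v" where
  "lap f = (\<chi> i. \<Sum>j\<in>UNIV. w i j * (f $ i - f $ j))"

text \<open>Positions are integers so that negating \<open>pos\<close> reverses the order. The
  entries are weighted indegrees minus one of the acyclic orientation given by the order.\<close>

definition order_vec :: "('v \<Rightarrow> int) \<Rightarrow> int ^ 'v" where
  "order_vec pos = (\<chi> i. (\<Sum>j\<in>{j. pos j < pos i}. w i j) - 1)"

text \<open>The analogue of the canonical divisor of a graph, whose entries are the valencies minus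
  2.\<close>

definition canonical :: "int ^ 'v" where
  "canonical = (\<chi> i. (\<Sum>j\<in>UNIV. w i j) - 2)"

definition extremal :: "(int ^ 'v) set" where
  "extremal = {order_vec pos + lap f | pos f. inj pos}"

text \<open>The total debt of \<open>x\<close>, weighted by \<open>R\<close>; the burning argument
  minimises it.\<close>

definition neg_deg :: "int ^ 'v \<Rightarrow> int" where
  "neg_deg x = (\<Sum>i\<in>UNIV. max 0 (- x $ i) * int (R $ i))"

lemma lap_nth: "lap f $ i = (\<Sum>j\<in>UNIV. w i j * (f $ i - f $ j))"
  by (simp add: lap_def)

lemma lap_add: "lap (f + g) = lap f + lap g"
  by (simp add: lap_def vec_eq_iff algebra_simps sum.distrib sum_subtractf)

lemma lap_minus: "lap (- f) = - lap f"
  by (simp add: lap_def vec_eq_iff algebra_simps flip: sum_negf)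

lemma lap_diff: "lap (f - g) = lap f - lap g"
  using lap_add[of f "- g"] by (simp add: lap_minus)

lemma lap_shift: "lap (\<chi> i. f $ i - c) = lap f"
  by (simp add: lap_def)

section \<open>Degree and kernel of the Laplacian\<close>

lemma deg_add: "deg R (x + y) = deg R x + deg R y"
  by (simp add: deg_def distrib_right sum.distrib)

lemma deg_diff: "deg R (x - y) = deg R x - deg R y"
  by (simp add: deg_def left_diff_distrib sum_subtractf)

lemma deg_mono: "x \<le> y \<Longrightarrow> deg R x \<le> deg R y"
  unfolding deg_def by (intro sum_mono mult_right_mono) (auto simp: less_eq_vec_def)

text \<open>Reversibility turns the double sum into one of \<open>t i j - t j i\<close>, which
  cancels.\<close>

lemma deg_lap: "deg R (lap f) = 0"
proof -
  define t where "t i j = int (R $ i) * w i j * f $ i" for i j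
  have "deg R (lap f) = (\<Sum>i\<in>UNIV. \<Sum>j\<in>UNIV. t i j - int (R $ i) * w i j * f $ j)"
    by (simp add: deg_def lap_nth t_def sum_distrib_left sum_distrib_right algebra_simps)
  also have "\<dots> = (\<Sum>i\<in>UNIV. \<Sum>j\<in>UNIV. t i j - t j i)"
    by (simp add: t_def w_reversible)
  also have "\<dots> = (\<Sum>i\<in>UNIV. \<Sum>j\<in>UNIV. t i j) - (\<Sum>i\<in>UNIV. \<Sum>j\<in>UNIV. t j i)"
    by (simp add: sum_subtractf)
  also have "(\<Sum>i\<in>UNIV. \<Sum>j\<in>UNIV. t j i) = (\<Sum>i\<in>UNIV. \<Sum>j\<in>UNIV. t i j)"
    by (rule sum.swap)
  finally show ?thesis by simp
qed

text \<open>Maximum principle: where \<open>f\<close> is maximal, all terms of \<open>lap f\<close>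
  are nonnegative and hence vanish, so the maximum spreads along positive weights to every vertex.
  The value at \<open>q\<close> then fixes the constant.\<close>

lemma lap_injective:
  assumes "lap f = 0" "f $ q = 0"
  shows "f = 0"
proof -
  define m where "m = Max (range (($) f))"
  have le: "f $ i \<le> m" for i
    by (simp add: m_def)
  have "m \<in> range (($) f)"
    unfolding m_def by (rule Max_in) auto
  then obtain p where p: "f $ p = m"
    by auto
  have step: "f $ j = m" if "f $ i = m" "0 < w i j" for i j
  proof -
    have "(\<Sum>j\<in>UNIV. w i j * (f $ i - f $ j)) = 0"
      using assms(1) by (metis lap_nth zero_index)
    moreover have "0 \<le> w i k * (f $ i - f $ k)" for k
      using le[of k] that(1) w_nonneg by simp
    ultimately have "w i j * (f $ i - f $ j) = 0"
      by (subst (asm) sum_nonneg_eq_0_iff) auto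
    then show ?thesis
      using that by simp
  qed
  have "f $ j = m" for j
    using w_connected[of p j] by (induction rule: rtrancl_induct) (use p step in auto)
  then show ?thesis
    using assms(2) by (metis vec_eq_iff zero_index)
qed

section \<open>Vectors of linear orders\<close>

lemma order_vec_reverse:
  assumes "inj pos"
  shows "order_vec pos + order_vec (\<lambda>i. - pos i) = canonical"
proof -
  have "(\<Sum>j\<in>{j. pos j < pos i}. w i j) + (\<Sum>j\<in>{j. pos i < pos j}. w i j) = (\<Sum>j\<in>UNIV. w i j)" for i
  proof -
    have "(\<Sum>j\<in>UNIV. w i j) = (\<Sum>j\<in>UNIV - {i}. w i j)"
      by (subst sum.remove[of _ i]) (auto simp: w_diag)
    also have "UNIV - {i} = {j. pos j < pos i} \<union> {j. pos i < pos j}"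
      using assms by (auto simp: inj_eq not_less order_less_le)
    also have "sum (w i) \<dots> = sum (w i) {j. pos j < pos i} + sum (w i) {j. pos i < pos j}"
      by (rule sum.union_disjoint) auto
    finally show ?thesis by simp
  qed
  then show ?thesis
    by (simp add: order_vec_def canonical_def vec_eq_iff algebra_simps)
qed

text \<open>By reversibility the weight of a pair of vertices may be charged to either end, so it
  counts the same whichever vertex comes first.\<close>

lemma deg_order_vec_reverse: "deg R (order_vec (\<lambda>i. - pos i)) = deg R (order_vec pos)"
proof -
  define t where "t i j = (if pos j < pos i then w i j * int (R $ i) else 0)" for i j
  have 1: "deg R (order_vec pos) = (\<Sum>i\<in>UNIV. \<Sum>j\<in>UNIV. t i j) - (\<Sum>i\<in>UNIV. int (R $ i))"
    by (simp add: deg_def order_vec_def t_def sum_subtractf left_diff_distrib sum_distrib_right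
        sum.If_cases)
  have "deg R (order_vec (\<lambda>i. - pos i)) =
      (\<Sum>i\<in>UNIV. \<Sum>j\<in>UNIV. if pos i < pos j then w i j * int (R $ i) else 0) - (\<Sum>i\<in>UNIV. int (R $ i))"
    by (simp add: deg_def order_vec_def sum_subtractf left_diff_distrib sum_distrib_right
        sum.If_cases)
  also have "(\<Sum>i\<in>UNIV. \<Sum>j\<in>UNIV. if pos i < pos j then w i j * int (R $ i) else 0) =
      (\<Sum>i\<in>UNIV. \<Sum>j\<in>UNIV. t j i)"
    using w_reversible by (intro sum.cong refl) (simp add: t_def mult.commute)
  also have "\<dots> = (\<Sum>i\<in>UNIV. \<Sum>j\<in>UNIV. t i j)"
    by (rule sum.swap)
  finally show ?thesis using 1 by simp
qed

text \<open>An order vector and its reverse have equal degree and sum to \<open>canonical\<close>;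
  hence all extremal vectors share one degree.\<close>

lemma deg_extremal:
  assumes "\<nu> \<in> extremal"
  shows "2 * deg R \<nu> = deg R canonical"
proof -
  obtain pos f where \<nu>: "\<nu> = order_vec pos + lap f" "inj pos"
    using assms by (auto simp: extremal_def)
  then show ?thesis
    using deg_order_vec_reverse[of pos]
    by (simp add: deg_add deg_lap flip: order_vec_reverse[OF \<nu>(2)])
qed

lemma canonical_minus_extremal:
  assumes "\<nu> \<in> extremal"
  shows "canonical - \<nu> \<in> extremal"
proof -
  obtain pos f where \<nu>: "\<nu> = order_vec pos + lap f" "inj pos"
    using assms by (auto simp: extremal_def)
  then have "canonical - \<nu> = order_vec (\<lambda>i. - pos i) + lap (- f)"
    by (simp add: lap_minus flip: order_vec_reverse[OF \<nu>(2)])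
  moreover have "inj (\<lambda>i. - pos i)"
    using \<nu>(2) by (simp add: inj_def)
  ultimately show ?thesis
    by (auto simp: extremal_def)
qed

lemma extremal_nonempty: "extremal \<noteq> {}"
proof -
  obtain h :: "'v \<Rightarrow> nat" where "inj h"
    using finite_imp_inj_to_nat_seg[of "UNIV :: 'v set"] by auto
  then have "inj (\<lambda>i. int (h i))"
    by (simp add: inj_def)
  then show ?thesis
    by (auto simp: extremal_def)
qed

text \<open>Among the vertices where \<open>f\<close> is maximal, take one of least position. Every
  earlier vertex has a value smaller by at least 1, so \<open>lap f\<close> is at least the sum of
  the earlier weights there, one more than the order vector.\<close>

lemma order_vec_not_ge_lap: "\<not> lap f \<le> order_vec pos"
proof
  assume le: "lap f \<le> order_vec pos"
  define m where "m = Max (range (($) f))"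
  have f_le: "f $ i \<le> m" for i
    by (simp add: m_def)
  have "m \<in> range (($) f)"
    unfolding m_def by (rule Max_in) auto
  then have "{i. f $ i = m} \<noteq> {}"
    by auto
  then obtain i where i: "f $ i = m" and first: "\<And>j. f $ j = m \<Longrightarrow> pos i \<le> pos j"
    using ex_min_if_finite[of "pos ` {i. f $ i = m}"] by (force simp: not_less)
  have "(\<Sum>j\<in>{j. pos j < pos i}. w i j) \<le> (\<Sum>j\<in>{j. pos j < pos i}. w i j * (f $ i - f $ j))"
  proof (rule sum_mono)
    fix j assume "j \<in> {j. pos j < pos i}"
    then have "f $ j \<noteq> m"
      using first by force
    then have "1 \<le> f $ i - f $ j"
      using f_le[of j] i by simp
    then show "w i j \<le> w i j * (f $ i - f $ j)"
      using mult_left_mono[OF _ w_nonneg, of 1 "f $ i - f $ j"] by simp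
  qed
  also have "\<dots> \<le> lap f $ i"
    unfolding lap_nth by (rule sum_mono2) (auto simp: i f_le w_nonneg)
  also have "\<dots> \<le> order_vec pos $ i"
    using le by (simp add: less_eq_vec_def)
  finally show False
    by (simp add: order_vec_def)
qed

section \<open>The burning argument\<close>

text \<open>\<open>P v B\<close> reads: \<open>v\<close> catches fire once \<open>B\<close> has
  burnt. The hypothesis says that the fire never stops early, and \<open>pos\<close> records the
  order of burning.\<close>

lemma burning_order:
  fixes P :: "'v \<Rightarrow> 'v set \<Rightarrow> bool"
  assumes "\<And>A. A \<noteq> {} \<Longrightarrow> \<exists>v\<in>A. P v (- A)"
  obtains pos :: "'v \<Rightarrow> int" where "inj pos" "\<And>v. P v {u. pos u < pos v}"
proof -
  \<comment> \<open>Generalised for the induction: \<open>A\<close> is the unburnt set, and its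
    complement counts as already burnt.\<close>
  have "\<exists>pos :: 'v \<Rightarrow> int. inj_on pos A \<and> (\<forall>v\<in>A. P v ({u\<in>A. pos u < pos v} \<union> - A))" for A
    using finite[of A]
  proof (induction A rule: finite_psubset_induct)
    case (psubset A)
    show ?case
    proof (cases "A = {}")
      case False
      then obtain v where v: "v \<in> A" "P v (- A)"
        using assms by blast
      then obtain pos :: "'v \<Rightarrow> int" where pos: "inj_on pos (A - {v})"
        "\<And>x. x \<in> A - {v} \<Longrightarrow> P x ({u\<in>A - {v}. pos u < pos x} \<union> - (A - {v}))"
        using psubset.IH[of "A - {v}"] by blast
      \<comment> \<open>The vertex \<open>v\<close> that burns next must precede the rest of
        \<open>A\<close>, so its position lies below all values of \<open>pos\<close>.\<close>
      define c where "c = Min (pos ` UNIV) - 1"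
      have c: "c < pos u" for u
      proof -
        have "c < Min (range pos)"
          unfolding c_def by linarith
        also have "\<dots> \<le> pos u"
          by (rule Min_le) auto
        finally show ?thesis .
      qed
      define pos' where "pos' = pos(v := c)"
      have "inj_on pos' A"
        using pos(1) c by (auto simp: pos'_def inj_on_def)
      moreover have "P x ({u\<in>A. pos' u < pos' x} \<union> - A)" if "x \<in> A" for x
      proof (cases "x = v")
        case True
        then have "{u\<in>A. pos' u < pos' x} \<union> - A = - A"
          using c by (auto simp: pos'_def dest: less_asym split: if_splits)
        then show ?thesis
          using True v by simp
      next
        case False
        then have "{u\<in>A. pos' u < pos' x} \<union> - A = {u\<in>A - {v}. pos u < pos x} \<union> - (A - {v})"
          using v c by (auto simp: pos'_def)
        then show ?thesis
          using pos(2)[of x] that False by simp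
      qed
      ultimately show ?thesis by blast
    qed auto
  qed
  from this[of UNIV] that show ?thesis by auto
qed

section \<open>Total debt and finiteness\<close>

lemma neg_deg_nonneg: "0 \<le> neg_deg x"
  by (simp add: neg_deg_def sum_nonneg)

lemma finite_bounded_vectors: "finite {x :: int ^ 'v. \<forall>i. \<bar>x $ i\<bar> \<le> B}"
proof -
  have "finite (vec_lambda ` (PiE UNIV (\<lambda>_ :: 'v. {- B..B})))"
    by (intro finite_imageI finite_PiE) auto
  moreover have "{x :: int ^ 'v. \<forall>i. \<bar>x $ i\<bar> \<le> B} \<subseteq> vec_lambda ` (PiE UNIV (\<lambda>_ :: 'v. {- B..B}))"
  proof
    fix x :: "int ^ 'v"
    assume "x \<in> {x. \<forall>i. \<bar>x $ i\<bar> \<le> B}"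
    then have "($) x \<in> PiE UNIV (\<lambda>_. {- B..B})"
      by (auto simp: PiE_iff abs_le_iff minus_le_iff)
    then have "vec_lambda (($) x) \<in> vec_lambda ` (PiE UNIV (\<lambda>_. {- B..B}))"
      by (rule imageI)
    then show "x \<in> vec_lambda ` (PiE UNIV (\<lambda>_. {- B..B}))"
      by simp
  qed
  ultimately show ?thesis
    by (rule finite_subset[rotated])
qed

text \<open>Uses \<open>R $ i\<close> \<ge> 1 and the fact that an absolute value is the number plus
  twice its negative part. Since the degree is constant on translates, a bound on the debt bounds
  all entries.\<close>

lemma abs_nth_le: "\<bar>x $ i\<bar> \<le> deg R x + 2 * neg_deg x"
proof -
  have "\<bar>x $ i\<bar> \<le> \<bar>x $ i\<bar> * int (R $ i)"
    using R_pos[of i] mult_left_mono[of 1 "int (R $ i)" "\<bar>x $ i\<bar>"] by simp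
  also have "\<dots> \<le> (\<Sum>j\<in>UNIV. \<bar>x $ j\<bar> * int (R $ j))"
    by (rule member_le_sum) auto
  also have "\<dots> = (\<Sum>j\<in>UNIV. x $ j * int (R $ j) + 2 * (max 0 (- x $ j) * int (R $ j)))"
    by (intro sum.cong refl) (auto simp: max_def abs_if)
  also have "\<dots> = deg R x + 2 * neg_deg x"
    by (simp add: deg_def neg_deg_def sum.distrib sum_distrib_left)
  finally show ?thesis .
qed

lemma neg_deg_mono: "(\<And>i. - y $ i \<le> max 0 (- x $ i)) \<Longrightarrow> neg_deg y \<le> neg_deg x"
  unfolding neg_deg_def by (intro sum_mono mult_right_mono) auto

lemma neg_deg_strict_mono:
  assumes "\<And>i. - y $ i \<le> max 0 (- x $ i)" "x $ q < 0" "x $ q < y $ q"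
  shows "neg_deg y < neg_deg x"
  unfolding neg_deg_def
proof (rule sum_strict_mono_ex1)
  show "\<forall>i\<in>UNIV. max 0 (- y $ i) * int (R $ i) \<le> max 0 (- x $ i) * int (R $ i)"
    using assms(1) by (intro ballI mult_right_mono) auto
  show "\<exists>i\<in>UNIV. max 0 (- y $ i) * int (R $ i) < max 0 (- x $ i) * int (R $ i)"
    using assms(2,3) R_pos[of q] by (intro bexI[of _ q] mult_strict_right_mono) auto
qed auto

text \<open>Subtracting \<open>lap a\<close> fires each vertex of \<open>A\<close> once: a vertex of
  \<open>A\<close> pays its total weight to the complement, and no other vertex loses
  anything.\<close>

lemma lap_indicator:
  fixes A :: "'v set"
  defines "a \<equiv> (\<chi> i. if i \<in> A then 1 else 0)"
  shows "i \<in> A \<Longrightarrow> lap a $ i = (\<Sum>j\<in>- A. w i j)"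
    and "i \<notin> A \<Longrightarrow> lap a $ i \<le> 0"
proof -
  assume "i \<in> A"
  then have "lap a $ i = (\<Sum>j\<in>UNIV. if j \<in> - A then w i j else 0)"
    unfolding lap_nth a_def by (intro sum.cong refl) auto
  then show "lap a $ i = (\<Sum>j\<in>- A. w i j)"
    by (simp add: sum.If_cases Compl_eq)
next
  assume "i \<notin> A"
  then show "lap a $ i \<le> 0"
    unfolding lap_nth a_def by (intro sum_nonpos) (auto simp: w_nonneg)
qed

text \<open>The translates lie in a finite box by \<open>abs_nth_le\<close>, and the normalisation
  at \<open>q\<close> makes the script recoverable from its translate.\<close>

lemma finite_neg_deg_le: "finite {f. f $ q = 0 \<and> neg_deg (D - lap f) \<le> m}" (is "finite ?F")
proof (rule finite_imageD)
  show "finite ((\<lambda>f. D - lap f) ` ?F)"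
  proof (rule finite_subset)
    show "(\<lambda>f. D - lap f) ` ?F \<subseteq> {x. \<forall>i. \<bar>x $ i\<bar> \<le> deg R D + 2 * m}"
    proof clarify
      fix f i
      assume "neg_deg (D - lap f) \<le> m"
      then show "\<bar>(D - lap f) $ i\<bar> \<le> deg R D + 2 * m"
        using abs_nth_le[of "D - lap f" i] by (simp add: deg_diff deg_lap)
    qed
  qed (rule finite_bounded_vectors)
  show "inj_on (\<lambda>f. D - lap f) ?F"
  proof (rule inj_onI)
    fix f g
    assume *: "f \<in> ?F" "g \<in> ?F" "D - lap f = D - lap g"
    then have "lap (f - g) = 0" "(f - g) $ q = 0"
      by (auto simp: lap_diff)
    then have "f - g = 0"
      by (rule lap_injective)
    then show "f = g" by simp
  qed
qed

text \<open>Among the translates of \<open>D\<close> with the least negative part, a vertex \<open>q\<close> in debt stays in debt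
  when a set \<open>A\<close> of vertices that can afford it fires, since otherwise the negative part would
  shrink. So \<open>q\<close> never fires, only finitely many firing scripts remain, and the one with the largest
  sum admits no further firing.\<close>

lemma below_extremal:
  assumes "\<And>f. \<not> lap f \<le> D"
  obtains \<nu> where "\<nu> \<in> extremal" "D \<le> \<nu>"
proof -
  obtain f0 where f0: "\<And>f. neg_deg (D - lap f0) \<le> neg_deg (D - lap f)"
    using ex_has_least_nat[of "\<lambda>_. True" 0 "\<lambda>f. nat (neg_deg (D - lap f))"]
    by (auto simp: neg_deg_nonneg nat_le_eq_zle)
  define m where "m = neg_deg (D - lap f0)"
  obtain q where q: "(D - lap f0) $ q < 0"
    using assms[of f0] by (auto simp: less_eq_vec_def not_le)
  \<comment> \<open>Fixing \<open>f $ q = 0\<close> removes the additive constants. As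
    \<open>q\<close> is in debt it lies in no set that can afford to fire, so firing preserves this
    normalisation.\<close>
  define F where "F = {f. f $ q = 0 \<and> neg_deg (D - lap f) = m \<and> (D - lap f) $ q < 0}"
  have "finite F"
    by (rule finite_subset[OF _ finite_neg_deg_le[of q D m]]) (auto simp: F_def)
  moreover have "(\<chi> i. f0 $ i - f0 $ q) \<in> F"
    using q by (simp add: F_def lap_shift m_def)
  ultimately obtain f where f: "f \<in> F"
    and f_max: "\<And>g. g \<in> F \<Longrightarrow> (\<Sum>i\<in>UNIV. g $ i) \<le> (\<Sum>i\<in>UNIV. f $ i)"
    using ex_is_arg_min_if_finite[of F "\<lambda>f. - (\<Sum>i\<in>UNIV. f $ i)"]
    by (force simp: is_arg_min_linorder)
  have burn: "\<exists>v\<in>A. (D - lap f) $ v < (\<Sum>j\<in>- A. w v j)" if "A \<noteq> {}" for A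
  proof (rule ccontr)
    assume "\<not> ?thesis"
    then have legal: "(\<Sum>j\<in>- A. w v j) \<le> (D - lap f) $ v" if "v \<in> A" for v
      using that by force
    define a :: "int ^ 'v" where "a = (\<chi> i. if i \<in> A then 1 else 0)"
    have "0 \<le> (D - lap f) $ v" if "v \<in> A" for v
      using legal[OF that] sum_nonneg[of "- A" "w v"] by (simp add: w_nonneg)
    then have "q \<notin> A"
      using f by (force simp: F_def)
    \<comment> \<open>Vertices of \<open>A\<close> stay nonnegative because they can afford the
      firing, and the others do not lose, so no debt grows.\<close>
    have le: "- (D - lap (f + a)) $ v \<le> max 0 (- (D - lap f) $ v)" for v
      using lap_indicator[of v A] legal[of v] by (cases "v \<in> A") (auto simp: lap_add a_def)
    have least: "m \<le> neg_deg (D - lap (f + a))"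
      using f0 by (simp add: m_def)
    have "neg_deg (D - lap (f + a)) \<le> neg_deg (D - lap f)"
      by (rule neg_deg_mono) (rule le)
    then have "neg_deg (D - lap (f + a)) = m"
      using least f by (simp add: F_def)
    moreover have "(D - lap (f + a)) $ q \<le> (D - lap f) $ q"
      using neg_deg_strict_mono[of "D - lap (f + a)" "D - lap f" q] le least f
      by (force simp: F_def)
    ultimately have "f + a \<in> F"
      using f \<open>q \<notin> A\<close> by (auto simp: F_def a_def)
    \<comment> \<open>The maximal sum of \<open>f\<close> is contradicted, as this firing raises it
      by \<open>card A\<close>.\<close>
    then have "(\<Sum>i\<in>UNIV. a $ i) \<le> 0"
      using f_max by (force simp: sum.distrib)
    moreover have "(\<Sum>i\<in>UNIV. a $ i) = int (card A)"
      by (simp add: a_def sum.If_cases)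
    ultimately show False
      using that by (simp add: card_gt_0_iff)
  qed
  obtain pos :: "'v \<Rightarrow> int" where pos: "inj pos"
    "\<And>v. (D - lap f) $ v < (\<Sum>j\<in>{u. pos u < pos v}. w v j)"
  proof (rule burning_order[of "\<lambda>v S. (D - lap f) $ v < (\<Sum>j\<in>S. w v j)"])
    show "\<exists>v\<in>A. (D - lap f) $ v < (\<Sum>j\<in>- A. w v j)" if "A \<noteq> {}" for A
      using that by (rule burn)
  qed (rule that)
  \<comment> \<open>The burning inequality is strict between integers, which absorbs the
    \<open>- 1\<close> in \<open>order_vec\<close>.\<close>
  have "D $ v \<le> (order_vec pos + lap f) $ v" for v
    using pos(2)[of v] by (simp add: order_vec_def)
  then show ?thesis
    using that[of "order_vec pos + lap f"] pos(1) by (auto simp: extremal_def less_eq_vec_def)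
qed

section \<open>The Riemann-Roch formula\<close>

text \<open>One direction is the burning argument; for the other, subtracting \<open>lap f\<close>
  reduces to \<open>order_vec_not_ge_lap\<close>.\<close>

lemma Sig_range_lap: "D \<in> Sig (range lap) \<longleftrightarrow> (\<exists>\<nu>\<in>extremal. D \<le> \<nu>)"
proof
  assume "D \<in> Sig (range lap)"
  then show "\<exists>\<nu>\<in>extremal. D \<le> \<nu>"
    using below_extremal[of D] by (auto simp: Sig_def)
next
  assume "\<exists>\<nu>\<in>extremal. D \<le> \<nu>"
  then obtain pos f where *: "D \<le> order_vec pos + lap f"
    by (auto simp: extremal_def)
  have False if "lap g \<le> D" for g
  proof -
    have "lap g \<le> order_vec pos + lap f"
      using that * by (rule order_trans)
    then have "lap (g - f) \<le> order_vec pos"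
      by (auto simp: lap_diff less_eq_vec_def algebra_simps)
    then show False
      by (simp add: order_vec_not_ge_lap)
  qed
  then show "D \<in> Sig (range lap)"
    by (auto simp: Sig_def)
qed

lemma linear_system_empty_iff: "linear_system (range lap) D = {} \<longleftrightarrow> (\<exists>\<nu>\<in>extremal. D \<le> \<nu>)"
proof -
  have "(\<exists>E. 0 \<le> E \<and> E - D \<in> range lap) \<longleftrightarrow> (\<exists>f. lap f \<le> D)"
  proof
    assume "\<exists>E. 0 \<le> E \<and> E - D \<in> range lap"
    then obtain E f where "0 \<le> E" "E - D = lap f"
      by auto
    then have "lap (- f) = D - E" "D - E \<le> D"
      by (simp_all add: lap_minus less_eq_vec_def flip: \<open>E - D = lap f\<close>)
    then show "\<exists>f. lap f \<le> D"
      by metis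
  next
    assume "\<exists>f. lap f \<le> D"
    then obtain f where "lap f \<le> D" by blast
    then have "0 \<le> D - lap f" "(D - lap f) - D = lap (- f)"
      by (auto simp: less_eq_vec_def lap_minus)
    then show "\<exists>E. 0 \<le> E \<and> E - D \<in> range lap"
      by (metis rangeI)
  qed
  then show ?thesis
    by (auto simp: linear_system_def Sig_def simp flip: Sig_range_lap)
qed

text \<open>The rank plus one is the least degree of an effective \<open>E\<close> that brings
  \<open>D\<close> below an extremal vector. Since \<open>LEAST\<close> ranges over the integers,
  attainment needs a witness and the lower bound 0.\<close>

lemma rr_rank_minimum:
  obtains E \<nu> where "0 \<le> E" "\<nu> \<in> extremal" "D - E \<le> \<nu>" "rr_rank R (range lap) D = deg R E - 1"
    "\<And>E' \<nu>'. 0 \<le> E' \<Longrightarrow> \<nu>' \<in> extremal \<Longrightarrow> D - E' \<le> \<nu>' \<Longrightarrow> deg R E \<le> deg R E'"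
proof -
  define P where "P d \<longleftrightarrow> (\<exists>E. 0 \<le> E \<and> linear_system (range lap) (D - E) = {} \<and> d = deg R E)" for d
  obtain \<nu> where \<nu>: "\<nu> \<in> extremal"
    using extremal_nonempty by blast
  \<comment> \<open>Entrywise absolute values make the subtracted vector effective and bring
    \<open>D\<close> below \<nu>.\<close>
  have "P (deg R (\<chi> i. \<bar>D $ i - \<nu> $ i\<bar>))"
    unfolding P_def linear_system_empty_iff
    by (rule exI[of _ "\<chi> i. \<bar>D $ i - \<nu> $ i\<bar>"])
      (use \<nu> in \<open>auto simp: less_eq_vec_def intro!: bexI[of _ \<nu>]\<close>)
  moreover have nonneg: "0 \<le> d" if "P d" for d
    using that by (auto simp: P_def deg_def less_eq_vec_def intro!: sum_nonneg)
  ultimately obtain d where "P d" and "\<And>e. P e \<Longrightarrow> nat d \<le> nat e"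
    using ex_has_least_nat[of P _ nat] by blast
  then have least: "d \<le> e" if "P e" for e
    using nonneg that by (simp add: nat_le_eq_zle)
  have "rr_rank R (range lap) D = d - 1"
    unfolding rr_rank_def P_def[symmetric] using Least_equality[of P, OF \<open>P d\<close> least] by simp
  moreover obtain E \<mu> where E: "0 \<le> E" "\<mu> \<in> extremal" "D - E \<le> \<mu>" "d = deg R E"
    using \<open>P d\<close> by (auto simp: P_def linear_system_empty_iff)
  moreover have "deg R E \<le> deg R E'" if "0 \<le> E'" "\<nu>' \<in> extremal" "D - E' \<le> \<nu>'" for E' \<nu>'
    using least[of "deg R E'"] that E(4) by (auto simp: P_def linear_system_empty_iff)
  ultimately show ?thesis
    using that[of E \<mu>] by blast
qed

lemma rr_rank_le:
  assumes "0 \<le> E" "\<nu> \<in> extremal" "D - E \<le> \<nu>"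
  shows "rr_rank R (range lap) D \<le> deg R E - 1"
  using rr_rank_minimum[of D] assms by (metis diff_right_mono)

text \<open>If \<open>E\<close> is optimal for \<open>D\<close> with \<open>D - E\<close> \<le>
  \<nu>, then the slack \<open>\<nu> - D + E\<close> is effective and brings
  \<open>canonical - D\<close> below the extremal vector \<open>canonical - \<nu>\<close>. The
  vector \<open>\<nu>'\<close> only names the common degree.\<close>

lemma rr_rank_canonical_minus_le:
  assumes "\<nu>' \<in> extremal"
  shows "rr_rank R (range lap) (canonical - D) \<le> rr_rank R (range lap) D - deg R D + deg R \<nu>'"
proof -
  obtain E \<nu> where E: "0 \<le> E" "\<nu> \<in> extremal" "D - E \<le> \<nu>" "rr_rank R (range lap) D = deg R E - 1"
    by (rule rr_rank_minimum)
  have "rr_rank R (range lap) (canonical - D) \<le> deg R (\<nu> - D + E) - 1"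
  proof (rule rr_rank_le)
    show "0 \<le> \<nu> - D + E"
      using E(3) by (auto simp: less_eq_vec_def algebra_simps)
    show "canonical - \<nu> \<in> extremal"
      using E(2) by (rule canonical_minus_extremal)
    show "canonical - D - (\<nu> - D + E) \<le> canonical - \<nu>"
      using E(1) by (auto simp: less_eq_vec_def)
  qed
  moreover have "deg R \<nu> = deg R \<nu>'"
    using deg_extremal[OF E(2)] deg_extremal[OF assms] by simp
  ultimately show ?thesis
    using E(4) by (simp add: deg_add deg_diff)
qed

text \<open>Extremal vectors have maximal degree in all of \<open>Sig\<close>. Conversely, a vector
  strictly below one can be raised by a unit vector without leaving \<open>Sig\<close>, so it is not
  even a local maximum.\<close>

lemma Ext_range_lap: "Ext R (range lap) = extremal"
proof
  show "extremal \<subseteq> Ext R (range lap)"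
  proof
    fix \<nu>
    assume \<nu>: "\<nu> \<in> extremal"
    have "deg R p \<le> deg R \<nu>" if "p \<in> Sig (range lap)" for p
    proof -
      obtain \<nu>' where "\<nu>' \<in> extremal" "p \<le> \<nu>'"
        using \<open>p \<in> Sig (range lap)\<close> by (auto simp: Sig_range_lap)
      then show ?thesis
        using deg_mono[of p \<nu>'] deg_extremal[of \<nu>'] deg_extremal[OF \<nu>] by simp
    qed
    then show "\<nu> \<in> Ext R (range lap)"
      using \<nu> by (auto simp: Ext_def Sig_range_lap)
  qed
  show "Ext R (range lap) \<subseteq> extremal"
  proof
    fix x
    assume x: "x \<in> Ext R (range lap)"
    then obtain \<nu> where \<nu>: "\<nu> \<in> extremal" "x \<le> \<nu>"
      by (auto simp: Ext_def Sig_range_lap)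
    have "x = \<nu>"
    proof (rule ccontr)
      assume "x \<noteq> \<nu>"
      then obtain i where i: "x $ i < \<nu> $ i"
        using \<nu>(2) by (auto simp: vec_eq_iff less_eq_vec_def order_less_le)
      have "x + axis i 1 \<le> \<nu>"
        using \<nu>(2) i by (auto simp: less_eq_vec_def axis_def)
      then have "x + axis i 1 \<in> Sig (range lap)"
        using \<nu>(1) by (auto simp: Sig_range_lap)
      moreover have "(\<Sum>j\<in>UNIV. \<bar>(x + axis i 1) $ j - x $ j\<bar>) \<le> 1"
        by (simp add: axis_def if_distrib[of abs] cong: if_cong)
      ultimately have "deg R (x + axis i 1) \<le> deg R x"
        using x by (auto simp: Ext_def)
      moreover have "deg R (axis i 1) = int (R $ i)"
        by (simp add: deg_def axis_def if_distrib[of "\<lambda>x. x * _"] cong: if_cong)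
      ultimately show False
        using R_pos[of i] by (simp add: deg_add)
    qed
    then show "x \<in> extremal"
      using \<nu>(1) by simp
  qed
qed

theorem riemann_roch_range_lap: "riemann_roch_property R (range lap)"
proof -
  obtain \<nu> where \<nu>: "\<nu> \<in> extremal"
    using extremal_nonempty by blast
  define g where "g = deg R \<nu> + 1"
  have deg_ext: "deg R \<mu> = g - 1" if "\<mu> \<in> extremal" for \<mu>
    using deg_extremal[OF that] deg_extremal[OF \<nu>] by (simp add: g_def)
  have deg_K: "deg R canonical = 2 * g - 2"
    using deg_extremal[OF \<nu>] by (simp add: g_def)
  \<comment> \<open>Duality for \<open>D\<close> and for \<open>canonical - D\<close> gives opposite
    inequalities, as \<open>canonical\<close> has twice the common degree.\<close>
  have "rr_rank R (range lap) D - rr_rank R (range lap) (canonical - D) = deg R D - g + 1" for D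
    using rr_rank_canonical_minus_le[OF \<nu>, of D] rr_rank_canonical_minus_le[OF \<nu>, of "canonical - D"]
    by (simp add: deg_diff deg_K g_def)
  then show ?thesis
    unfolding riemann_roch_property_def Ext_range_lap
    using \<nu> deg_ext deg_K by blast
qed

end

section \<open>The associated digraph\<close>

lemma span_columns_int:
  fixes M :: "int ^ 'n::finite ^ 'm::finite"
  shows "module.span (*s) (columns M) = range ((*v) M)"
proof -
  interpret m: module "(*s) :: int \<Rightarrow> int ^ 'm \<Rightarrow> int ^ 'm"
    by unfold_locales (auto simp: vec_eq_iff algebra_simps)
  show ?thesis
  proof
    show "m.span (columns M) \<subseteq> range ((*v) M)"
    proof (rule m.span_minimal)
      have "column i M = M *v axis i 1" for i
        by (simp add: matrix_vector_mult_def column_def axis_def vec_eq_iff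
            if_distrib[of "\<lambda>x. _ * x"] cong: if_cong)
      then show "columns M \<subseteq> range ((*v) M)"
        by (auto simp: columns_def)
      have "0 \<in> range ((*v) M)"
        by (metis matrix_vector_mult_0_right rangeI)
      moreover have "M *v x + M *v y \<in> range ((*v) M)" for x y
        by (metis matrix_vector_right_distrib rangeI)
      moreover have "c *s (M *v x) = M *v (c *s x)" for c x
        by (simp add: matrix_vector_mult_def vec_eq_iff sum_distrib_left mult.left_commute)
      ultimately show "m.subspace (range ((*v) M))"
        by (auto simp: m.subspace_def)
    qed
    have "M *v x \<in> m.span (columns M)" for x
    proof -
      have "M *v x = (\<Sum>i\<in>UNIV. x $ i *s column i M)"
        by (rule matrix_mult_sum)
      also have "\<dots> \<in> m.span (columns M)"
        by (intro m.span_sum m.span_scale m.span_base) (auto simp: columns_def)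
      finally show ?thesis .
    qed
    then show "range ((*v) M) \<subseteq> m.span (columns M)"
      by auto
  qed
qed

lemma card_assoc_digraph_arcs:
  fixes G :: "('v::finite, 'e) multigraph"
  shows "int (card {a \<in> arcs (assoc_digraph G R). tail (assoc_digraph G R) a = i \<and>
      head (assoc_digraph G R) a = j}) = adj_matrix G $ i $ j * int (R $ j)"
proof -
  have "{a \<in> arcs (assoc_digraph G R). tail (assoc_digraph G R) a = i \<and>
      head (assoc_digraph G R) a = j} =
    (\<lambda>(e, k). (e, i, j, k)) ` ({e \<in> edges G. ends G e = {i, j}} \<times> {..<R $ j})"
    by (auto simp: assoc_digraph_def image_iff)
  then show ?thesis
    by (simp add: card_image inj_on_def card_cartesian_product adj_matrix_def)
qed

lemma finite_assoc_digraph_arcs: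
  assumes "finite (edges G)"
  shows "finite (arcs (assoc_digraph G R))"
proof (rule finite_subset)
  show "arcs (assoc_digraph G R) \<subseteq> edges G \<times> UNIV \<times> (SIGMA j:UNIV. {..<R $ j})"
    by (auto simp: assoc_digraph_def)
qed (use assms in auto)

lemma out_degree_assoc_digraph:
  fixes G :: "('v::finite, 'e) multigraph"
  assumes "finite (edges G)"
  shows "int (out_degree (assoc_digraph G R) i) = (\<Sum>j\<in>UNIV. adj_matrix G $ i $ j * int (R $ j))"
proof -
  let ?H = "assoc_digraph G R"
  have "out_arcs ?H i = (\<Union>j. {a \<in> arcs ?H. tail ?H a = i \<and> head ?H a = j})"
    by (auto simp: out_arcs_def)
  then have "out_degree ?H i = card (\<Union>j. {a \<in> arcs ?H. tail ?H a = i \<and> head ?H a = j})"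
    by (simp add: out_degree_def)
  also have "\<dots> = (\<Sum>j\<in>UNIV. card {a \<in> arcs ?H. tail ?H a = i \<and> head ?H a = j})"
    by (rule card_UN_disjoint) (auto simp: finite_assoc_digraph_arcs[OF assms])
  finally show ?thesis
    by (simp add: card_assoc_digraph_arcs)
qed

theorem theorem4p1:
  fixes G :: "('v::finite, 'e) multigraph" and R :: "nat ^ 'v"
  assumes "arithmetical_graph G R"
  shows "column_riemann_roch R (assoc_digraph G R)"
proof -
  have conn: "connected_multigraph G" and R: "\<And>i. 0 < R $ i"
    using assms by (auto simp: arithmetical_graph_def)
  have fin: "finite (edges G)" and loopless: "\<And>e. e \<in> edges G \<Longrightarrow> card (ends G e) = 2"
    and path: "\<And>u v. (u, v) \<in> {(i, j). \<exists>e\<in>edges G. ends G e = {i, j}}\<^sup>*"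
    using conn by (auto simp: connected_multigraph_def)
  define w where "w i j = adj_matrix G $ i $ j * int (R $ j)" for i j
  interpret reversible_weights R w
  proof
    fix i j
    show "0 < R $ i" by (rule R)
    show "0 \<le> w i j"
      by (simp add: w_def adj_matrix_def)
    have no_loops: "{e \<in> edges G. ends G e = {i, i}} = {}"
      using loopless by force
    show "w i i = 0"
      unfolding w_def adj_matrix_def vec_lambda_beta no_loops by simp
    show "int (R $ i) * w i j = int (R $ j) * w j i"
      by (simp add: w_def adj_matrix_def insert_commute)
    have "{(i, j). \<exists>e\<in>edges G. ends G e = {i, j}} \<subseteq> {(i, j). 0 < w i j}"
      using fin R by (auto simp: w_def adj_matrix_def card_gt_0_iff zero_less_mult_iff)
    then show "(i, j) \<in> {(i, j). 0 < w i j}\<^sup>*"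
      using path[of i j] rtrancl_mono by blast
  qed
  \<comment> \<open>The out-degree of \<open>i\<close> is the sum of the \<open>w i j\<close>, so
    each row combines into differences \<open>f $ i - f $ j\<close>.\<close>
  have "(*v) (laplacian (assoc_digraph G R)) = lap"
    by (simp add: fun_eq_iff vec_eq_iff laplacian_def diag_matrix_def matrix_vector_mult_def
        card_assoc_digraph_arcs out_degree_assoc_digraph[OF fin] lap_nth w_def
        left_diff_distrib right_diff_distrib sum_subtractf sum_distrib_right
        if_distrib[of "\<lambda>x. x * _"] cong: if_cong)
  then show ?thesis
    unfolding column_riemann_roch_def column_lattice_def span_columns_int
    using riemann_roch_range_lap by simp
qed

end
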